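(* Let $W$ be the dihedral Coxeter group $I_2(m)$ ($m\geq2$) and $k$ a positive integer. For any Coxeter element $c$, the multi-cluster complex $\Delta^k_c(I_2(m))$ is isomorphic to the boundary complex of a $2k$-dimensional cyclic polytope on $2k+m$ vertices.
   Context: $I_2(m)$ is generated by $S=\{a,b\}$ with $a^2=b^2=(ab)^m=1$; its longest element $w_\circ$ has length $m$. For a Coxeter element $c$ with reduced word $\mathbf{c}$, $\mathbf{w}_\circ(\mathbf{c})$ is the lexicographically first (as a sequence of positions) subword of $\mathbf{c}\mathbf{c}\cdots$ which is a reduced expression for $w_\circ$; the multi-cluster complex is the subword complex $\Delta^k_c(W)=\Delta(\mathbf{c}^k\mathbf{w}_\circ(\mathbf{c}),w_\circ)$, where for a word $Q$ and $\pi\in W$, $\Delta(Q,\pi)$ is the simplicial complex on the positions of $Q$ whose faces are the sets $P$ of positions such that deleting them leaves a word containing a reduced expression for $\pi$ as a subword. *)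

theory Defs
  imports "HOL-Analysis.Analysis" "HOL-Algebra.Group" "HOL-Library.Sublist"
begin

text \<open>
  A Coxeter system is given by its Coxeter matrix \<open>M\<close>, indexed by the type \<open>'s\<close> of simple
  generators; \<open>M s t = 0\<close> encodes the absence of a relation between \<open>s\<close> and \<open>t\<close>.
\<close>

definition coxeter_matrix :: "('s \<Rightarrow> 's \<Rightarrow> nat) \<Rightarrow> bool" where
  "coxeter_matrix M \<longleftrightarrow>
     (\<forall>s. M s s = 1) \<and> (\<forall>s t. M s t = M t s) \<and> (\<forall>s t. s \<noteq> t \<longrightarrow> M s t \<noteq> 1)"

text \<open>
  The monoid congruence on words generated by \<open>(s t)^(M s t) = 1\<close>.  As \<open>M s s = 1\<close> makes every
  generator an involution, the quotient is also the group with this presentation.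
\<close>

inductive coxeter_cong :: "('s \<Rightarrow> 's \<Rightarrow> nat) \<Rightarrow> 's list \<Rightarrow> 's list \<Rightarrow> bool"
  for M :: "'s \<Rightarrow> 's \<Rightarrow> nat" where
  relator: "coxeter_cong M (u @ concat (replicate (M s t) [s, t]) @ v) (u @ v)"
| refl: "coxeter_cong M u u"
| sym: "coxeter_cong M u v \<Longrightarrow> coxeter_cong M v u"
| trans: "coxeter_cong M u v \<Longrightarrow> coxeter_cong M v w \<Longrightarrow> coxeter_cong M u w"

definition coxeter_rel :: "('s \<Rightarrow> 's \<Rightarrow> nat) \<Rightarrow> ('s list \<times> 's list) set" where
  "coxeter_rel M = {(u, v). coxeter_cong M u v}"

definition word_elt :: "('s \<Rightarrow> 's \<Rightarrow> nat) \<Rightarrow> 's list \<Rightarrow> 's list set" where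
  "word_elt M w = coxeter_rel M `` {w}"

definition coxeter_group :: "('s \<Rightarrow> 's \<Rightarrow> nat) \<Rightarrow> 's list set monoid" where
  "coxeter_group M =
     \<lparr>carrier = UNIV // coxeter_rel M,
      mult = (\<lambda>X Y. \<Union>u\<in>X. \<Union>v\<in>Y. word_elt M (u @ v)),
      one = word_elt M []\<rparr>"

lemma equiv_coxeter_rel: "equiv UNIV (coxeter_rel M)"
  by (rule equivI)
     (auto simp: coxeter_rel_def refl_on_def sym_def trans_def intro: coxeter_cong.intros)

lemma word_elt_eq_iff: "word_elt M u = word_elt M v \<longleftrightarrow> coxeter_cong M u v"
  unfolding word_elt_def
  using eq_equiv_class_iff[OF equiv_coxeter_rel, of u v M] by (simp add: coxeter_rel_def)

lemma carrier_coxeter_group: "carrier (coxeter_group M) = range (word_elt M)"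
  by (auto simp: coxeter_group_def quotient_def word_elt_def)

lemma coxeter_cong_context:
  "coxeter_cong M u v \<Longrightarrow> coxeter_cong M (x @ u @ y) (x @ v @ y)"
proof (induction rule: coxeter_cong.induct)
  case (relator u s t v)
  show ?case using coxeter_cong.relator[of M "x @ u" s t "v @ y"] by simp
qed (blast intro: coxeter_cong.intros)+

lemma coxeter_cong_append:
  assumes "coxeter_cong M u u'" "coxeter_cong M v v'"
  shows "coxeter_cong M (u @ v) (u' @ v')"
  using coxeter_cong_context[OF assms(1), of "[]" v] coxeter_cong_context[OF assms(2), of u' "[]"]
  by (auto intro: coxeter_cong.trans)

lemma mult_word_elt:
  "word_elt M u \<otimes>\<^bsub>coxeter_group M\<^esub> word_elt M v = word_elt M (u @ v)"
proof -
  have "word_elt M (u' @ v') = word_elt M (u @ v)"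
    if "u' \<in> word_elt M u" "v' \<in> word_elt M v" for u' v'
    using that by (auto simp: word_elt_eq_iff)
      (auto simp: word_elt_def coxeter_rel_def intro: coxeter_cong.sym coxeter_cong_append)
  moreover have "w \<in> word_elt M w" for w
    by (simp add: word_elt_def coxeter_rel_def coxeter_cong.refl)
  ultimately show ?thesis
    unfolding coxeter_group_def monoid.simps by blast
qed

lemma coxeter_cong_rev:
  assumes "coxeter_matrix M"
  shows "coxeter_cong M (rev w @ w) []"
proof (induction w)
  case Nil
  show ?case by (simp add: coxeter_cong.refl)
next
  case (Cons s w)
  have "coxeter_cong M (rev w @ [s, s] @ w) (rev w @ w)"
    using coxeter_cong.relator[of M "rev w" s s w] assms by (simp add: coxeter_matrix_def)
  with Cons show ?case by (auto intro: coxeter_cong.trans)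
qed

lemma group_coxeter_group:
  assumes "coxeter_matrix M"
  shows "group (coxeter_group M)"
proof (rule groupI)
  have one: "\<one>\<^bsub>coxeter_group M\<^esub> = word_elt M []"
    by (simp add: coxeter_group_def)
  show "\<one>\<^bsub>coxeter_group M\<^esub> \<in> carrier (coxeter_group M)"
    by (simp add: one carrier_coxeter_group)
  fix x assume "x \<in> carrier (coxeter_group M)"
  then obtain u where x: "x = word_elt M u" by (auto simp: carrier_coxeter_group)
  show "\<one>\<^bsub>coxeter_group M\<^esub> \<otimes>\<^bsub>coxeter_group M\<^esub> x = x"
    by (simp add: one x mult_word_elt)
  have "word_elt M (rev u) \<otimes>\<^bsub>coxeter_group M\<^esub> x = \<one>\<^bsub>coxeter_group M\<^esub>"
    using coxeter_cong_rev[OF assms] by (simp add: one x mult_word_elt word_elt_eq_iff)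
  then show "\<exists>y\<in>carrier (coxeter_group M). y \<otimes>\<^bsub>coxeter_group M\<^esub> x = \<one>\<^bsub>coxeter_group M\<^esub>"
    by (auto simp: carrier_coxeter_group)
qed (auto simp: carrier_coxeter_group mult_word_elt)

definition cox_length :: "('s \<Rightarrow> 's \<Rightarrow> nat) \<Rightarrow> 's list set \<Rightarrow> nat" where
  "cox_length M x = (LEAST n. \<exists>w. word_elt M w = x \<and> length w = n)"

definition reduced_expression ::
    "('s \<Rightarrow> 's \<Rightarrow> nat) \<Rightarrow> 's list set \<Rightarrow> 's list \<Rightarrow> bool" where
  "reduced_expression M x w \<longleftrightarrow> word_elt M w = x \<and> length w = cox_length M x"

text \<open>Meaningful for finite Coxeter groups, where the element of maximal length is unique.\<close>

definition longest_element :: "('s \<Rightarrow> 's \<Rightarrow> nat) \<Rightarrow> 's list set" where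
  "longest_element M = (THE x. x \<in> carrier (coxeter_group M) \<and>
     (\<forall>y\<in>carrier (coxeter_group M). cox_length M y \<le> cox_length M x))"

definition coxeter_element :: "('s \<Rightarrow> 's \<Rightarrow> nat) \<Rightarrow> 's list set \<Rightarrow> bool" where
  "coxeter_element M c \<longleftrightarrow> (\<exists>w. distinct w \<and> set w = UNIV \<and> c = word_elt M w)"

text \<open>The subword of the infinite word \<open>c c c \<dots>\<close> at a list of positions.\<close>

definition periodic_subword :: "'s list \<Rightarrow> nat list \<Rightarrow> 's list" where
  "periodic_subword c ps = map (\<lambda>i. c ! (i mod length c)) ps"

definition w0_positions :: "('s \<Rightarrow> 's \<Rightarrow> nat) \<Rightarrow> 's list \<Rightarrow> nat list \<Rightarrow> bool" where
  "w0_positions M c ps \<longleftrightarrow> sorted_wrt (<) ps \<and>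
     reduced_expression M (longest_element M) (periodic_subword c ps)"

definition c_sorting_word :: "('s \<Rightarrow> 's \<Rightarrow> nat) \<Rightarrow> 's list \<Rightarrow> 's list" where
  "c_sorting_word M c = periodic_subword c
     (THE ps. w0_positions M c ps \<and>
        (\<forall>qs. w0_positions M c qs \<longrightarrow> ps = qs \<or> (ps, qs) \<in> lexord {(i, j). i < j}))"

definition subword_complex ::
    "('s \<Rightarrow> 's \<Rightarrow> nat) \<Rightarrow> 's list \<Rightarrow> 's list set \<Rightarrow> nat set set" where
  "subword_complex M Q x = {P. P \<subseteq> {..<length Q} \<and>
     (\<exists>u. reduced_expression M x u \<and> subseq u (nths Q ({..<length Q} - P)))}"

definition multi_cluster_complex ::
    "('s \<Rightarrow> 's \<Rightarrow> nat) \<Rightarrow> nat \<Rightarrow> 's list \<Rightarrow> nat set set" where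
  "multi_cluster_complex M k c =
     subword_complex M (concat (replicate k c) @ c_sorting_word M c) (longest_element M)"

datatype dihedral_gen = gen_a | gen_b

definition I2 :: "nat \<Rightarrow> dihedral_gen \<Rightarrow> dihedral_gen \<Rightarrow> nat" where
  "I2 m s t = (if s = t then 1 else m)"

lemma coxeter_matrix_I2: "m \<ge> 2 \<Longrightarrow> coxeter_matrix (I2 m)"
  by (auto simp: coxeter_matrix_def I2_def)

text \<open>
  The moment curve \<open>t \<mapsto> (t, t^2, \<dots>, t^d)\<close>; the index type \<open>'d\<close> carries no order, so \<open>e\<close> numbers the
  coordinates by \<open>1, \<dots>, d\<close>.
\<close>

definition moment_curve :: "('d \<Rightarrow> nat) \<Rightarrow> real \<Rightarrow> real ^ 'd" where
  "moment_curve e t = (\<chi> i. t ^ e i)"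

definition cyclic_polytope :: "nat \<Rightarrow> (real ^ 'd) set \<Rightarrow> bool" where
  "cyclic_polytope n P \<longleftrightarrow> CARD('d) < n \<and>
     (\<exists>e T. bij_betw e (UNIV :: 'd set) {1..CARD('d)} \<and> finite T \<and> card T = n \<and>
        P = convex hull (moment_curve e ` T))"

definition boundary_complex :: "'a::real_vector set \<Rightarrow> 'a set set" where
  "boundary_complex P = {F. F face_of P \<and> F \<noteq> P}"

definition vertex_scheme :: "'a::real_vector set set \<Rightarrow> 'a set set" where
  "vertex_scheme C = (\<lambda>F. {v. v extreme_point_of F}) ` C"

definition complex_isomorphic :: "'a set set \<Rightarrow> 'b set set \<Rightarrow> bool" where
  "complex_isomorphic K L \<longleftrightarrow> (\<exists>f. bij_betw f (\<Union>K) (\<Union>L) \<and> (`) f ` K = L)"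

end

theory Submission
  imports Defs "HOL-Number_Theory.Cong"
begin

text \<open>
  The word \<open>c^k w\<^sub>0(c)\<close> is the alternating word of length \<open>n = 2k + m\<close>, and the reduced expressions of
  the longest element are the two alternating words of length \<open>m\<close>. Hence a set \<open>W\<close> of positions is a
  face iff the parities of the positions outside \<open>W\<close> form at least \<open>m\<close> runs.

  On the other side, let \<open>t\<^sub>0 < t\<^sub>1 < \<dots>\<close> be the parameters of the \<open>n\<close> points on the moment curve. Faces
  of polytopes are exposed, so \<open>W\<close> is the vertex set of a proper face iff some polynomial of degree at
  most \<open>2k\<close> vanishes at the \<open>t\<^sub>i\<close> with \<open>i \<in> W\<close> and is positive at the others. Dividing by the linear
  factors at \<open>W\<close> leaves a polynomial of degree at most \<open>2k - |W|\<close> with prescribed signs at the other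
  parameters, which exists iff there are at most \<open>2k - |W|\<close> sign changes. A sign change between
  consecutive positions outside \<open>W\<close> occurs exactly when their parities agree, so both conditions
  coincide.
\<close>

section \<open>Words in the dihedral group\<close>

fun other :: "dihedral_gen \<Rightarrow> dihedral_gen" where
  "other gen_a = gen_b"
| "other gen_b = gen_a"

lemma other_other [simp]: "other (other s) = s"
  by (cases s) auto

lemma other_neq [simp]: "other s \<noteq> s" "s \<noteq> other s"
  by (cases s; simp)+

lemma neq_iff_other: "s \<noteq> t \<longleftrightarrow> t = other s"
  by (cases s; cases t) auto

fun alt :: "dihedral_gen \<Rightarrow> nat \<Rightarrow> dihedral_gen list" where
  "alt s 0 = []"
| "alt s (Suc n) = s # alt (other s) n"

lemma length_alt [simp]: "length (alt s n) = n"
  by (induction n arbitrary: s) auto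

lemma alt_add: "alt s (i + j) = alt s i @ alt (if even i then s else other s) j"
  by (induction i arbitrary: s) auto

lemma rev_alt: "rev (alt s n) = alt (if even n then other s else s) n"
proof (induction n arbitrary: s)
  case (Suc n)
  show ?case
    using Suc[of "other s"] alt_add[of "if even n then s else other s" n 1] by auto
qed auto

lemma nth_alt: "i < n \<Longrightarrow> alt s n ! i = (if even i then s else other s)"
  by (induction n arbitrary: s i) (auto simp: nth_Cons split: nat.splits)

lemma concat_replicate_alt: "concat (replicate n [s, other s]) = alt s (2 * n)"
  by (induction n) auto

lemma distinct_adj_alt: "distinct_adj (alt s n)"
proof (induction n arbitrary: s)
  case (Suc n)
  then show ?case using Suc[of "other s"] by (cases n) auto
qed auto

lemma distinct_adj_imp_alt: "distinct_adj w \<Longrightarrow> w = alt (hd w) (length w)"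
proof (induction w)
  case (Cons s w)
  then show ?case
    by (cases w) (auto simp: distinct_adj_Cons neq_iff_other)
qed auto

text \<open>The action on \<open>\<int>\<close> by \<open>x \<mapsto> - x\<close> and \<open>x \<mapsto> 1 - x\<close> becomes an action of \<open>I\<^sub>2(m)\<close> modulo \<open>m\<close>.\<close>

fun act :: "dihedral_gen list \<Rightarrow> int \<Rightarrow> int" where
  "act [] x = x"
| "act (s # w) x = (case s of gen_a \<Rightarrow> - act w x | gen_b \<Rightarrow> 1 - act w x)"

lemma act_append: "act (u @ v) x = act u (act v x)"
  by (induction u) (auto split: dihedral_gen.splits)

lemma act_cong:
  assumes "[x = y] (mod m)"
  shows "[act u x = act u y] (mod m)"
  using assms
  by (induction u) (auto split: dihedral_gen.splits intro: cong_diff simp: cong_minus_minus_iff)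

text \<open>The products \<open>ab\<close> and \<open>ba\<close> act as translations by -1 and 1, so
  alternating words of even length are translations and those of odd length are reflections.\<close>

lemma act_alt:
  "act (alt s n) x =
     (case s of gen_a \<Rightarrow> if even n then x - int (n div 2) else - x - int (n div 2)
      | gen_b \<Rightarrow> if even n then x + int (n div 2) else 1 - x + int (n div 2))"
proof (induction n arbitrary: s)
  case (Suc n)
  then show ?case by (cases s) (auto elim!: evenE oddE)
qed (auto split: dihedral_gen.splits)

lemma act_relator: "[act (concat (replicate (I2 m s t) [s, t])) x = x] (mod int m)"
proof (cases "s = t")
  case True
  then show ?thesis by (cases t) (auto simp: I2_def)
next
  case False
  then have "t = other s" by (simp add: neq_iff_other)
  then have "act (concat (replicate (I2 m s t) [s, t])) x = x - int m \<or>
      act (concat (replicate (I2 m s t) [s, t])) x = x + int m"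
    by (cases s) (auto simp: I2_def concat_replicate_alt act_alt simp del: other.simps)
  then show ?thesis by (auto simp: cong_iff_dvd_diff)
qed

text \<open>This makes the values of \<open>act\<close> modulo \<open>m\<close> invariants of group
  elements, able to tell them apart.\<close>

lemma coxeter_cong_act:
  "coxeter_cong (I2 m) u v \<Longrightarrow> [act u x = act v x] (mod int m)"
proof (induction arbitrary: x rule: coxeter_cong.induct)
  case (relator u s t v)
  show ?case unfolding act_append by (intro act_cong act_relator)
qed (auto intro: cong_sym cong_trans)

text \<open>Every relator has even length; this is the sign character.\<close>

lemma coxeter_cong_even_length:
  "coxeter_cong M u v \<Longrightarrow> even (length u) = even (length v)"
proof (induction rule: coxeter_cong.induct)
  case (relator u s t v)
  have "even (length (concat (replicate (M s t) [s, t])))"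
    by (simp add: length_concat sum_list_replicate)
  then show ?case by simp
qed auto

section \<open>Inverses, the braid relation and shortening of words\<close>

lemma coxeter_cong_cancel:
  assumes "coxeter_cong M (u @ v) []" and "coxeter_matrix M"
  shows "coxeter_cong M u (rev v)"
proof -
  have "coxeter_cong M (v @ rev v) []"
    using coxeter_cong_rev[OF assms(2), of "rev v"] by simp
  from coxeter_cong_context[OF this, of u "[]"] coxeter_cong_context[OF assms(1), of "[]" "rev v"]
  show ?thesis by (auto intro: coxeter_cong.sym coxeter_cong.trans)
qed

text \<open>The relator \<open>(st)^m\<close> is alternating of length \<open>2 * m\<close>. Moving
  its second half to the other side reverses it into the alternating word that starts with the other
  letter.\<close>

lemma braid:
  assumes "m \<ge> 2"
  shows "coxeter_cong (I2 m) (alt s m) (alt t m)"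
proof (cases "s = t")
  case True
  then show ?thesis by (simp add: coxeter_cong.refl)
next
  case False
  then have t: "t = other s" by (simp add: neq_iff_other)
  have "coxeter_cong (I2 m) (alt s (m + m)) []"
    using coxeter_cong.relator[of "I2 m" "[]" s t "[]"]
    by (simp add: I2_def concat_replicate_alt t mult_2)
  then have "coxeter_cong (I2 m) (alt s m @ alt (if even m then s else other s) m) []"
    by (simp only: alt_add)
  from coxeter_cong_cancel[OF this coxeter_matrix_I2[OF assms]] show ?thesis
    by (simp add: rev_alt t split: if_splits)
qed

lemma shorten_repeat:
  assumes "m \<ge> 2" and "\<not> distinct_adj w"
  shows "\<exists>w'. coxeter_cong (I2 m) w w' \<and> length w' < length w"
  using assms(2)
proof (induction w)
  case (Cons s w)
  show ?case
  proof (cases "distinct_adj w")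
    case True
    with Cons.prems obtain v where v: "w = s # v"
      by (cases w) (auto simp: distinct_adj_Cons)
    have "coxeter_cong (I2 m) (s # s # v) v"
      using coxeter_cong.relator[of "I2 m" "[]" s s v] by (simp add: I2_def)
    with v show ?thesis by auto
  next
    case False
    then obtain w' where w': "coxeter_cong (I2 m) w w'" "length w' < length w"
      using Cons.IH by blast
    then show ?thesis
      using coxeter_cong_context[OF w'(1), of "[s]" "[]"] by (intro exI[of _ "s # w'"]) auto
  qed
qed auto

text \<open>In the alternating case the word is \<open>s\<close> followed by an alternating block of
  length \<open>m\<close> and a rest; the braid relation makes the block start with \<open>s\<close>
  too, and the two letters \<open>s\<close> cancel.\<close>

lemma shorten_long:
  assumes "m \<ge> 2" and "m < length w"
  shows "\<exists>w'. coxeter_cong (I2 m) w w' \<and> length w' < length w"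
proof (cases "distinct_adj w")
  case False
  then show ?thesis by (rule shorten_repeat[OF assms(1)])
next
  case True
  define s where "s = hd w"
  obtain j where j: "length w = Suc m + j"
    using assms(2) by (metis less_imp_add_positive add_Suc_shift less_iff_Suc_add)
  obtain v where "alt s (Suc m + j) = alt s (Suc m) @ v"
    using alt_add by blast
  with distinct_adj_imp_alt[OF True] j have w: "w = alt s (Suc m) @ v"
    by (simp add: s_def)
  obtain l where l: "m = Suc l" using assms(1) by (cases m) auto
  have "coxeter_cong (I2 m) ([s] @ alt (other s) m @ v) ([s] @ alt s m @ v)"
    by (intro coxeter_cong_context braid assms(1))
  moreover have "coxeter_cong (I2 m) ([s] @ alt s m @ v) (alt (other s) l @ v)"
    using coxeter_cong.relator[of "I2 m" "[]" s s "alt (other s) l @ v"]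
    by (simp add: I2_def l)
  ultimately have "coxeter_cong (I2 m) w (alt (other s) l @ v)"
    unfolding w by (auto intro: coxeter_cong.trans)
  moreover have "length (alt (other s) l @ v) < length w"
    by (simp add: w l)
  ultimately show ?thesis by blast
qed

section \<open>Reduced expressions and the longest element\<close>

lemma reduced_expression_minimal:
  assumes "reduced_expression M x w" and "coxeter_cong M w w'"
  shows "length w \<le> length w'"
proof -
  have "word_elt M w' = x"
    using assms by (simp add: reduced_expression_def word_elt_eq_iff[symmetric])
  then have "cox_length M x \<le> length w'"
    unfolding cox_length_def by (intro Least_le) auto
  with assms(1) show ?thesis by (simp add: reduced_expression_def)
qed

lemma reduced_expression_exists: "\<exists>w'. reduced_expression M (word_elt M w) w'"
proof -
  have "\<exists>n w'. word_elt M w' = word_elt M w \<and> length w' = n" by auto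
  from LeastI_ex[OF this] show ?thesis
    by (auto simp: reduced_expression_def cox_length_def)
qed

lemma reduced_expression_I2:
  assumes "m \<ge> 2" and "reduced_expression (I2 m) x w"
  shows "distinct_adj w" and "length w \<le> m"
  using reduced_expression_minimal[OF assms(2)] shorten_repeat[OF assms(1), of w]
    shorten_long[OF assms(1), of w]
  by (meson not_less)+

text \<open>
  The value at \<open>0\<close> separates the lengths: alternating words of length \<open>l < m\<close>, \<open>l \<equiv> m\<close> mod \<open>2\<close>, send
  \<open>0\<close> to an integer that exceeds the value for \<open>alt gen_a m\<close> by more than \<open>0\<close> and less than \<open>m\<close>.
\<close>

lemma cong_alt_imp_length:
  assumes "m \<ge> 2" and "l \<le> m" and "coxeter_cong (I2 m) (alt s l) (alt gen_a m)"
  shows "l = m"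
proof -
  have ev: "even l = even m"
    using coxeter_cong_even_length[OF assms(3)] by simp
  from coxeter_cong_act[OF assms(3), of 0]
  have dvd: "int m dvd act (alt s l) 0 - act (alt gen_a m) 0"
    by (simp add: cong_iff_dvd_diff)
  show ?thesis
  proof (rule ccontr)
    assume "l \<noteq> m"
    with assms(2) have "l < m" by simp
    define d where "d = act (alt s l) 0 - act (alt gen_a m) 0"
    have "0 < d \<and> d < int m"
    proof (cases "even m")
      case True
      with ev \<open>l < m\<close> show ?thesis
        by (cases s) (auto simp: d_def act_alt elim!: evenE)
    next
      case False
      with ev \<open>l < m\<close> show ?thesis
        by (cases s) (auto simp: d_def act_alt elim!: oddE)
    qed
    with dvd show False
      unfolding d_def[symmetric] using zdvd_not_zless by blast
  qed
qed

text \<open>A reduced expression is alternating of length at most \<open>m\<close>. The braid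
  relation allows comparison with \<open>alt gen_a m\<close>, and the invariants then leave only
  length \<open>m\<close>.\<close>

lemma cox_length_alt:
  assumes "m \<ge> 2"
  shows "cox_length (I2 m) (word_elt (I2 m) (alt s m)) = m"
proof -
  obtain w where w: "reduced_expression (I2 m) (word_elt (I2 m) (alt s m)) w"
    using reduced_expression_exists by blast
  note r = reduced_expression_I2[OF assms w]
  from w have "coxeter_cong (I2 m) w (alt s m)"
    by (simp add: reduced_expression_def word_elt_eq_iff)
  then have "coxeter_cong (I2 m) (alt (hd w) (length w)) (alt gen_a m)"
    using braid[OF assms] distinct_adj_imp_alt[OF r(1)] by (metis coxeter_cong.trans)
  then have "length w = m"
    using cong_alt_imp_length[OF assms r(2)] by blast
  with w show ?thesis by (simp add: reduced_expression_def)
qed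

text \<open>An element of maximal length has an alternating reduced expression of length
  \<open>m\<close>, and the braid relation identifies the two candidates. This gives the uniqueness
  behind \<open>THE\<close> and leaves \<open>s\<close> free.\<close>

lemma longest_element_I2:
  assumes "m \<ge> 2"
  shows "longest_element (I2 m) = word_elt (I2 m) (alt s m)"
  unfolding longest_element_def
proof (rule the_equality)
  have le: "cox_length (I2 m) y \<le> m" if "y \<in> carrier (coxeter_group (I2 m))" for y
  proof -
    from that obtain w where "reduced_expression (I2 m) y w"
      using reduced_expression_exists by (auto simp: carrier_coxeter_group)
    with reduced_expression_I2(2)[OF assms this] show ?thesis
      by (simp add: reduced_expression_def)
  qed
  show "word_elt (I2 m) (alt s m) \<in> carrier (coxeter_group (I2 m)) \<and>
    (\<forall>y\<in>carrier (coxeter_group (I2 m)).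
       cox_length (I2 m) y \<le> cox_length (I2 m) (word_elt (I2 m) (alt s m)))"
    using le by (auto simp: carrier_coxeter_group cox_length_alt[OF assms])
  fix x
  assume x: "x \<in> carrier (coxeter_group (I2 m)) \<and>
    (\<forall>y\<in>carrier (coxeter_group (I2 m)). cox_length (I2 m) y \<le> cox_length (I2 m) x)"
  then have "m \<le> cox_length (I2 m) x"
    using cox_length_alt[OF assms, of s] by (metis carrier_coxeter_group rangeI)
  with le x have len: "cox_length (I2 m) x = m" by (meson order_antisym)
  from x obtain u where "x = word_elt (I2 m) u" by (auto simp: carrier_coxeter_group)
  then obtain w where w: "reduced_expression (I2 m) x w"
    using reduced_expression_exists by blast
  then have "w = alt (hd w) m"
    using distinct_adj_imp_alt[OF reduced_expression_I2(1)[OF assms w]] len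
    by (simp add: reduced_expression_def)
  with w have "x = word_elt (I2 m) (alt (hd w) m)"
    by (simp add: reduced_expression_def)
  then show "x = word_elt (I2 m) (alt s m)"
    using braid[OF assms] by (simp add: word_elt_eq_iff)
qed

lemma reduced_expression_longest_iff:
  assumes "m \<ge> 2"
  shows "reduced_expression (I2 m) (longest_element (I2 m)) w \<longleftrightarrow> distinct_adj w \<and> length w = m"
proof
  assume w: "reduced_expression (I2 m) (longest_element (I2 m)) w"
  then have "length w = m"
    using longest_element_I2[OF assms, of gen_a] cox_length_alt[OF assms, of gen_a]
    by (simp add: reduced_expression_def)
  with reduced_expression_I2(1)[OF assms w] show "distinct_adj w \<and> length w = m" by simp
next
  assume w: "distinct_adj w \<and> length w = m"
  then have "w = alt (hd w) m" using distinct_adj_imp_alt by blast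
  then show "reduced_expression (I2 m) (longest_element (I2 m)) w"
    using longest_element_I2[OF assms, of "hd w"] cox_length_alt[OF assms, of "hd w"] w
    by (simp add: reduced_expression_def)
qed

section \<open>Coxeter elements and the c-sorting word\<close>

lemma reduced_coxeter_element_I2:
  assumes "m \<ge> 2" and "coxeter_element (I2 m) c" and "reduced_expression (I2 m) c cw"
  shows "\<exists>s. cw = [s, other s]"
proof -
  obtain w where w: "distinct w" "set w = UNIV" "c = word_elt (I2 m) w"
    using assms(2) by (auto simp: coxeter_element_def)
  have UNIV2: "(UNIV :: dihedral_gen set) = {gen_a, gen_b}"
    using dihedral_gen.exhaust by auto
  have len: "length w = 2"
    using distinct_card[OF w(1)] w(2) by (simp add: UNIV2)
  have "distinct_adj w"
    using w(1) by (simp add: distinct_adj_conv_nth nth_eq_iff_index_eq)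
  then have walt: "w = alt (hd w) 2"
    using distinct_adj_imp_alt len by metis
  \<comment> \<open>For \<open>m = 2\<close> the generators commute, so \<open>cw\<close> may differ
    from \<open>w\<close> as a word; only congruence is available.\<close>
  have cong: "coxeter_cong (I2 m) cw w"
    using assms(3) w(3) by (simp add: reduced_expression_def word_elt_eq_iff)
  have "length cw \<le> 2" "even (length cw)"
    using reduced_expression_minimal[OF assms(3) cong] coxeter_cong_even_length[OF cong] len
    by auto
  \<comment> \<open>A Coxeter element is not the identity: it moves 0 to 1 or -1, which is nonzero
    modulo \<open>m\<close>.\<close>
  moreover have "cw \<noteq> []"
  proof
    assume "cw = []"
    with coxeter_cong_act[OF cong, of 0] have "int m dvd act w 0"
      by (simp add: cong_iff_dvd_diff)
    moreover have "act w 0 = 1 \<or> act w 0 = -1"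
      by (subst (1 2) walt) (cases "hd w"; simp add: act_alt)
    ultimately show False using assms(1) by auto
  qed
  ultimately have "length cw = 2"
    by (cases "length cw" rule: nat.exhaust) (auto simp: le_Suc_eq)
  then have "cw = alt (hd cw) 2"
    using distinct_adj_imp_alt[OF reduced_expression_I2(1)[OF assms(1,3)]] by simp
  then show ?thesis by (auto simp: numeral_2_eq_2)
qed

text \<open>Entry \<open>i\<close> of a strictly increasing list bounded below by \<open>j\<close>
  is at least \<open>j + i\<close>, so the interval is lexicographically least among such lists of
  its length.\<close>

lemma upt_lexord_le_sorted:
  assumes "sorted_wrt (<) qs" and "\<forall>q\<in>set qs. j \<le> q"
  shows "[j..<j + length qs] = qs \<or> ([j..<j + length qs], qs) \<in> lexord {(i, j). i < j}"
  using assms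
proof (induction qs arbitrary: j)
  case (Cons q qs)
  have upt: "[j..<j + length (q # qs)] = j # [Suc j..<Suc j + length qs]"
    by (simp add: upt_conv_Cons del: upt_Suc)
  show ?case
  proof (cases "j = q")
    case True
    have "\<forall>x\<in>set qs. Suc j \<le> x" using Cons.prems True by auto
    from Cons.IH[OF _ this] Cons.prems(1) show ?thesis
      unfolding upt using True by auto
  next
    case False
    then have "j < q" using Cons.prems(2) by auto
    then show ?thesis unfolding upt by simp
  qed
qed simp

lemma periodic_subword_upt: "periodic_subword [s, other s] [0..<m] = alt s m"
proof (rule nth_equalityI)
  fix i
  assume "i < length (periodic_subword [s, other s] [0..<m])"
  moreover have "[s, other s] ! (i mod 2) = (if even i then s else other s)"
    by (simp add: mod_2_eq_odd)
  ultimately show "periodic_subword [s, other s] [0..<m] ! i = alt s m ! i"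
    by (simp add: periodic_subword_def nth_alt numeral_2_eq_2)
qed (simp add: periodic_subword_def)

text \<open>The first \<open>m\<close> letters of the periodic word are already a reduced expression
  of the longest element.\<close>

lemma c_sorting_word_I2:
  assumes "m \<ge> 2"
  shows "c_sorting_word (I2 m) [s, other s] = alt s m"
proof -
  let ?first = "\<lambda>ps. w0_positions (I2 m) [s, other s] ps \<and>
    (\<forall>qs. w0_positions (I2 m) [s, other s] qs \<longrightarrow> ps = qs \<or> (ps, qs) \<in> lexord {(i, j). i < j})"
  have pos: "w0_positions (I2 m) [s, other s] qs \<longleftrightarrow>
      sorted_wrt (<) qs \<and> distinct_adj (periodic_subword [s, other s] qs) \<and> length qs = m" for qs
    by (auto simp: w0_positions_def reduced_expression_longest_iff[OF assms] periodic_subword_def)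
  have upt: "?first [0..<m]"
    using upt_lexord_le_sorted[of _ 0]
    by (auto simp: pos periodic_subword_upt distinct_adj_alt)
  have "(THE ps. ?first ps) = [0..<m]"
  proof (rule the_equality)
    show "?first [0..<m]" by (rule upt)
    fix ps
    assume ps: "?first ps"
    \<comment> \<open>Asymmetry of the strict order gives the uniqueness that \<open>THE\<close>
      requires.\<close>
    have "asym {(i :: nat, j). i < j}" by (auto simp: asym_iff)
    then have "asym (lexord {(i :: nat, j). i < j})" by (rule lexord_asym)
    then show "ps = [0..<m]" using upt ps asymD by metis
  qed
  then show ?thesis by (simp add: c_sorting_word_def periodic_subword_upt)
qed

section \<open>Runs of a word\<close>

abbreviation runs :: "'a list \<Rightarrow> nat" where
  "runs xs \<equiv> length (remdups_adj xs)"

lemma runs_le_Cons: "runs xs \<le> runs (x # xs)"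
  by (cases xs) auto

lemma runs_Cons_le: "runs (x # xs) \<le> Suc (runs xs)"
  by (cases xs) auto

text \<open>The extra letter \<open>z\<close> carries the induction: a matched head becomes the new
  \<open>z\<close>.\<close>

lemma subseq_runs_Cons_le: "subseq u xs \<Longrightarrow> runs (z # u) \<le> runs (z # xs)"
proof (induction u xs arbitrary: z rule: list_emb.induct)
  case (list_emb_Nil ys)
  then show ?case using remdups_adj_length_ge1[of "z # ys"] by simp
next
  case (list_emb_Cons xs ys y)
  have "runs (z # ys) \<le> runs (z # y # ys)"
    using runs_Cons_le[of z ys] runs_le_Cons[of ys y] by auto
  with list_emb_Cons.IH[of z] show ?case by simp
qed auto

lemma subseq_runs_le:
  assumes "subseq u xs"
  shows "runs u \<le> runs xs"
proof (cases xs)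
  case (Cons y ys)
  with subseq_runs_Cons_le[OF assms, of y] runs_le_Cons[of u y] show ?thesis by simp
qed (use assms in simp)

lemma subseq_remdups_adj: "subseq (remdups_adj xs) xs"
  by (induction xs rule: remdups_adj.induct) auto

text \<open>Passing to a subword cannot create runs; conversely, one letter from each of the first
  \<open>m\<close> runs suffices.\<close>

lemma alternating_subseq_iff:
  "(\<exists>u. distinct_adj u \<and> length u = m \<and> subseq u xs) \<longleftrightarrow> m \<le> runs xs"
proof
  assume "\<exists>u. distinct_adj u \<and> length u = m \<and> subseq u xs"
  then show "m \<le> runs xs"
    using subseq_runs_le by (metis distinct_adj_conv_length_remdups_adj)
next
  assume m: "m \<le> runs xs"
  let ?u = "take m (remdups_adj xs)"
  have "distinct_adj ?u"
    using distinct_adj_remdups_adj[of xs] by (metis append_take_drop_id distinct_adj_appendD1)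
  moreover have "subseq ?u xs"
    by (meson prefix_imp_subseq subseq_order.order_trans subseq_remdups_adj take_is_prefix)
  ultimately show "\<exists>u. distinct_adj u \<and> length u = m \<and> subseq u xs"
    using m by (intro exI[of _ ?u]) auto
qed

text \<open>Each adjacent pair starts a new run in exactly one of the two words, and each word has
  one initial run.\<close>

lemma runs_add_runs:
  fixes f g :: "'a \<Rightarrow> bool"
  assumes "successively (\<lambda>x y. (f x = f y) \<longleftrightarrow> (g x \<noteq> g y)) xs" and "xs \<noteq> []"
  shows "runs (map f xs) + runs (map g xs) = Suc (length xs)"
  using assms
proof (induction xs rule: induct_list012)
  case (3 x y zs)
  from 3(2) 3(3) have "runs (map f (y # zs)) + runs (map g (y # zs)) = Suc (length (y # zs))"
    by simp
  with 3(3) show ?case by (cases "f x = f y") auto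
qed auto

lemma runs_map_inj: "inj f \<Longrightarrow> runs (map f xs) = runs xs"
  by (simp add: remdups_adj_map_injective)

section \<open>The multi-cluster complex\<close>

definition remaining :: "nat \<Rightarrow> nat set \<Rightarrow> nat list" where
  "remaining n W = filter (\<lambda>i. i \<notin> W) [0..<n]"

lemma set_remaining: "set (remaining n W) = {..<n} - W"
  by (auto simp: remaining_def)

lemma sorted_remaining: "sorted_wrt (<) (remaining n W)"
  by (simp add: remaining_def sorted_wrt_filter)

lemma length_remaining:
  assumes "W \<subseteq> {..<n}"
  shows "length (remaining n W) = n - card W"
proof -
  have "distinct (remaining n W)" by (simp add: remaining_def)
  from distinct_card[OF this] show ?thesis
    using card_Diff_subset[OF finite_subset[OF assms] assms] by (simp add: set_remaining)
qed

lemma nths_alt: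
  "nths (alt s n) ({..<n} - W) = map (\<lambda>i. if even i then s else other s) (remaining n W)"
proof -
  have "nths (map f [0..<n]) ({..<n} - W) = map f (remaining n W)"
    for f :: "nat \<Rightarrow> dihedral_gen"
  proof (induction n)
    case (Suc n)
    have "nths (map f [0..<n]) ({..<Suc n} - W) = nths (map f [0..<n]) ({..<n} - W)"
      unfolding nths_def
      by (intro arg_cong[of _ _ "map fst"] filter_cong) (auto dest: set_zip_rightD)
    with Suc show ?case by (simp add: nths_append remaining_def)
  qed (simp add: remaining_def)
  moreover have "alt s n = map (\<lambda>i. if even i then s else other s) [0..<n]"
    by (rule nth_equalityI) (auto simp: nth_alt)
  ultimately show ?thesis by simp
qed

text \<open>The letter at a position is an injective function of its parity, so runs of letters are
  runs of parities.\<close>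

lemma multi_cluster_complex_I2:
  assumes "m \<ge> 2"
  shows "multi_cluster_complex (I2 m) k [s, other s] =
    {W. W \<subseteq> {..<2 * k + m} \<and> m \<le> runs (map even (remaining (2 * k + m) W))}"
proof -
  let ?n = "2 * k + m"
  have Q: "concat (replicate k [s, other s]) @ c_sorting_word (I2 m) [s, other s] = alt s ?n"
    by (simp add: concat_replicate_alt c_sorting_word_I2[OF assms] alt_add)
  have "inj (\<lambda>b. if b then s else other s)"
    by (auto simp: inj_def)
  from runs_map_inj[OF this, of "map even _"]
  have "runs (nths (alt s ?n) ({..<?n} - W)) = runs (map even (remaining ?n W))" for W
    by (simp add: nths_alt comp_def)
  then show ?thesis
    unfolding multi_cluster_complex_def subword_complex_def Q
    by (simp add: reduced_expression_longest_iff[OF assms] conj_assoc alternating_subseq_iff)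
qed

section \<open>Polynomials with prescribed zeros and signs\<close>

lemma sign_runs_le_degree:
  fixes h :: "real poly"
  assumes "sorted_wrt (<) xs" and "xs \<noteq> []" and "\<forall>x\<in>set xs. poly h x \<noteq> 0"
  shows "runs (map (\<lambda>x. poly h x > 0) xs) \<le> Suc (degree h)"
proof -
  \<comment> \<open>Each sign change yields a root by the intermediate value theorem. Keeping all
    roots to the right of the head ensures that the next one is new.\<close>
  have "\<exists>Z. finite Z \<and> (\<forall>z\<in>Z. hd xs < z \<and> poly h z = 0) \<and>
      runs (map (\<lambda>x. poly h x > 0) xs) = Suc (card Z)"
    using assms
  proof (induction xs rule: induct_list012)
    case (2 x)
    then show ?case by (intro exI[of _ "{}"]) auto
  next
    case (3 x y zs)
    then obtain Z where Z: "finite Z" "\<forall>z\<in>Z. y < z \<and> poly h z = 0"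
      "runs (map (\<lambda>x. poly h x > 0) (y # zs)) = Suc (card Z)"
      by auto
    have xy: "x < y" "poly h x \<noteq> 0" "poly h y \<noteq> 0" using 3(3,5) by auto
    show ?case
    proof (cases "(poly h x > 0) = (poly h y > 0)")
      case True
      with Z xy show ?thesis by (intro exI[of _ Z]) auto
    next
      case False
      with xy have "poly h x * poly h y < 0"
        by (auto simp: mult_less_0_iff)
      then obtain z where z: "x < z" "z < y" "poly h z = 0"
        using poly_IVT[OF xy(1)] by blast
      then have "z \<notin> Z" using Z(2) by force
      with False Z z xy show ?thesis by (intro exI[of _ "insert z Z"]) auto
    qed
  qed simp
  then obtain Z where Z: "finite Z" "\<forall>z\<in>Z. poly h z = 0"
    "runs (map (\<lambda>x. poly h x > 0) xs) = Suc (card Z)" by auto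
  have "h \<noteq> 0" using assms(2,3) by (cases xs) auto
  then have "card Z \<le> card {x. poly h x = 0}"
    using Z(2) by (intro card_mono poly_roots_finite) auto
  also have "\<dots> \<le> degree h" using \<open>h \<noteq> 0\<close> by (rule card_poly_roots_bound)
  finally show ?thesis using Z(3) by simp
qed

text \<open>Converse of the degree bound: the polynomial is built from right to left with one linear
  factor per sign change.\<close>

lemma poly_with_signs:
  fixes xs :: "real list"
  assumes "sorted_wrt (<) xs" and "xs \<noteq> []"
  shows "\<exists>h. degree h < runs (map \<sigma> xs) \<and>
    (\<forall>x\<in>set xs. if \<sigma> x then poly h x > 0 else poly h x < 0)"
proof -
  \<comment> \<open>The sign to the left of the head is recorded as well, since the next point will
    lie there.\<close>
  have "\<exists>h. degree h < runs (map \<sigma> xs) \<and>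
      (\<forall>x\<in>set xs. if \<sigma> x then poly h x > 0 else poly h x < 0) \<and>
      (\<forall>z\<le>hd xs. if \<sigma> (hd xs) then poly h z > 0 else poly h z < 0)"
    using assms
  proof (induction xs rule: induct_list012)
    case (2 x)
    then show ?case by (intro exI[of _ "if \<sigma> x then 1 else -1"]) auto
  next
    case (3 x y zs)
    then obtain h where h: "degree h < runs (map \<sigma> (y # zs))"
      "\<forall>v\<in>set (y # zs). if \<sigma> v then poly h v > 0 else poly h v < 0"
      "\<forall>z\<le>y. if \<sigma> y then poly h z > 0 else poly h z < 0"
      by auto
    have xy: "x < y" and yz: "\<forall>z\<in>set (y # zs). y \<le> z" using 3(3) by auto
    show ?case
    proof (cases "\<sigma> x = \<sigma> y")
      case True
      with h xy show ?thesis by (intro exI[of _ h]) auto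
    next
      case False
      \<comment> \<open>The factor with root at the midpoint is negative up to \<open>x\<close> and
        positive from \<open>y\<close> on, so it flips signs only on the left.\<close>
      define g where "g = [:- ((x + y) / 2), 1:] * h"
      have g: "poly g z = (z - (x + y) / 2) * poly h z" for z
        by (simp add: g_def algebra_simps)
      have "degree g \<le> Suc (degree h)"
        using degree_mult_le[of "[:- ((x + y) / 2), 1:]" h] by (simp add: g_def)
      then have "degree g < runs (map \<sigma> (x # y # zs))"
        using h(1) False by simp
      moreover have "if \<sigma> x then poly g z > 0 else poly g z < 0" if "z \<le> x" for z
      proof -
        have "z - (x + y) / 2 < 0" "z \<le> y" using that xy by auto
        with h(3) False show ?thesis
          unfolding g by (auto simp: zero_less_mult_iff mult_less_0_iff split: if_splits)
      qed
      moreover have "if \<sigma> z then poly g z > 0 else poly g z < 0" if "z \<in> set (y # zs)" for z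
      proof -
        have "z - (x + y) / 2 > 0" using that xy yz by force
        with h(2) that show ?thesis
          unfolding g by (auto simp: zero_less_mult_iff mult_less_0_iff split: if_splits)
      qed
      ultimately show ?thesis by (intro exI[of _ g]) auto
    qed
  qed simp
  then show ?thesis by blast
qed

lemma prod_linear_dvd:
  fixes p :: "'a::idom poly"
  assumes "finite W" and "inj_on t W" and "\<forall>i\<in>W. poly p (t i) = 0"
  shows "(\<Prod>i\<in>W. [:- t i, 1:]) dvd p"
  using assms
proof (induction W rule: finite_induct)
  case (insert w W)
  then obtain h where h: "p = (\<Prod>i\<in>W. [:- t i, 1:]) * h" by (auto elim: dvdE)
  have "poly (\<Prod>i\<in>W. [:- t i, 1:]) (t w) \<noteq> 0"
    using insert by (auto simp: poly_prod)
  then have "[:- t w, 1:] dvd h"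
    using insert.prems(2) h by (auto simp: poly_eq_0_iff_dvd)
  then have "[:- t w, 1:] * (\<Prod>i\<in>W. [:- t i, 1:]) dvd h * (\<Prod>i\<in>W. [:- t i, 1:])"
    by (rule mult_dvd_mono) simp
  then show ?case unfolding h prod.insert[OF insert(1,2)] by (subst (2) mult.commute)
qed simp

text \<open>The factor \<open>x - t i\<close> is negative exactly when
  \<open>x < t i\<close>.\<close>

lemma sign_prod_linear:
  fixes t :: "nat \<Rightarrow> real"
  assumes "finite W" and "\<forall>i\<in>W. t i \<noteq> x"
  shows "if even (card {i\<in>W. x < t i}) then poly (\<Prod>i\<in>W. [:- t i, 1:]) x > 0
         else poly (\<Prod>i\<in>W. [:- t i, 1:]) x < 0"
  using assms
proof (induction W rule: finite_induct)
  case (insert w W)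
  have "{i \<in> insert w W. x < t i} =
      (if x < t w then insert w {i\<in>W. x < t i} else {i\<in>W. x < t i})" by auto
  then have "card {i \<in> insert w W. x < t i} =
      (if x < t w then Suc (card {i\<in>W. x < t i}) else card {i\<in>W. x < t i})"
    using insert by simp
  moreover have "t w \<noteq> x" using insert.prems by simp
  ultimately show ?case
    using insert by (auto simp: zero_less_mult_iff mult_less_0_iff split: if_splits)
qed simp

lemma degree_prod_linear: "degree (\<Prod>i\<in>W. [:- t i, 1:] :: 'a::idom poly) = card W"
  by (subst degree_prod_sum_eq) auto

text \<open>Between consecutive remaining positions \<open>x < y\<close> all
  \<open>y - x - 1\<close> positions lie in \<open>W\<close>. The two counts differ by this number,
  which is odd iff \<open>x\<close> and \<open>y\<close> have equal parity.\<close>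

lemma successively_remaining:
  assumes "W \<subseteq> {..<n}"
  shows "successively (\<lambda>x y. (even (card {i\<in>W. x < i}) = even (card {i\<in>W. y < i}))
    \<longleftrightarrow> (even x \<noteq> even y)) (remaining n W)"
  unfolding successively_conv_nth
proof (intro allI impI)
  fix j
  let ?qs = "remaining n W"
  assume j: "Suc j < length ?qs"
  define x y where "x = ?qs ! j" and "y = ?qs ! Suc j"
  have "x < y" using sorted_remaining[of n W] j
    by (auto simp: x_def y_def sorted_wrt_nth_less)
  have xy: "x \<in> {..<n} - W" "y \<in> {..<n} - W"
    using j nth_mem[of j ?qs] nth_mem[of "Suc j" ?qs] by (simp_all add: x_def y_def set_remaining)
  have between: "z \<in> W" if "x < z" "z < y" for z
  proof (rule ccontr)
    assume "z \<notin> W"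
    with that xy have "z \<in> set ?qs" by (auto simp: set_remaining)
    then obtain l where l: "l < length ?qs" "z = ?qs ! l" by (auto simp: in_set_conv_nth)
    have nth_less: "a < b" if "?qs ! a < ?qs ! b" "a < length ?qs" for a b
    proof (rule ccontr)
      assume "\<not> a < b"
      then have "b = a \<or> ?qs ! b < ?qs ! a"
        using sorted_wrt_nth_less[OF sorted_remaining] that(2) by (metis linorder_neqE_nat)
      with that(1) show False by auto
    qed
    have "j < l" using nth_less \<open>x < z\<close> l j by (simp add: x_def)
    moreover have "l < Suc j" using nth_less \<open>z < y\<close> l by (simp add: y_def)
    ultimately show False by simp
  qed
  have fin: "finite W" using assms finite_subset by blast
  have "{i\<in>W. x < i} = {x<..<y} \<union> {i\<in>W. y < i}"
    using between xy(2) \<open>x < y\<close> by (auto, metis linorder_neqE_nat)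
  moreover have "card ({x<..<y} \<union> {i\<in>W. y < i}) = card {x<..<y} + card {i\<in>W. y < i}"
    using fin by (intro card_Un_disjoint) auto
  ultimately have "card {i\<in>W. x < i} = (y - Suc x) + card {i\<in>W. y < i}"
    by (simp only: card_greaterThanLessThan)
  moreover have "even (y - Suc x) \<longleftrightarrow> even x \<noteq> even y"
    using \<open>x < y\<close> by (cases "even x") simp_all
  ultimately show "(even (card {i\<in>W. ?qs ! j < i}) = even (card {i\<in>W. ?qs ! Suc j < i}))
      \<longleftrightarrow> (even (?qs ! j) \<noteq> even (?qs ! Suc j))"
    unfolding x_def[symmetric] y_def[symmetric] by (simp only: even_add) blast
qed

text \<open>For \<open>p = g * h\<close> the cofactor \<open>h\<close> must have sign pattern
  \<open>\<sigma>\<close>, which costs degree \<open>runs (map \<sigma> qs) - 1\<close>. By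
  \<open>runs_sum\<close> this fits into \<open>2 * k - card W\<close> iff the parities have at
  least \<open>m\<close> runs.\<close>

lemma supporting_poly_iff_runs:
  fixes t :: "nat \<Rightarrow> real"
  assumes t: "strict_mono_on {..<2 * k + m} t" and "m > 0" and W: "W \<subseteq> {..<2 * k + m}"
  shows "(W \<noteq> {..<2 * k + m} \<and> (\<exists>p. degree p \<le> 2 * k \<and> (\<forall>i\<in>W. poly p (t i) = 0) \<and>
       (\<forall>i\<in>{..<2 * k + m} - W. poly p (t i) > 0))) \<longleftrightarrow>
     m \<le> runs (map even (remaining (2 * k + m) W))"
proof -
  define n where "n = 2 * k + m"
  define qs where "qs = remaining n W"
  define \<sigma> where "\<sigma> = (\<lambda>q. even (card {i\<in>W. q < i}))"
  define g where "g = (\<Prod>i\<in>W. [:- t i, 1:])"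
  note t = t[folded n_def] and W = W[folded n_def]
  have fin: "finite W" using W finite_subset by blast
  have inj: "inj_on t {..<n}" using t strict_mono_on_imp_inj_on by blast
  have t_less: "t i < t j \<longleftrightarrow> i < j" if "i < n" "j < n" for i j
    using strict_mono_on_less[OF t] that by auto
  have len: "length qs + card W = n"
    using length_remaining[OF W] card_mono[OF _ W] by (simp add: qs_def)
  have sorted_t: "sorted_wrt (<) (map t qs)"
    unfolding sorted_wrt_map
    by (rule sorted_wrt_mono_rel[OF _ sorted_remaining[of n W, folded qs_def]])
      (auto simp: t_less qs_def set_remaining)
  have g_sign: "if \<sigma> q then poly g (t q) > 0 else poly g (t q) < 0" if "q \<in> set qs" for q
  proof -
    have q: "q < n" "q \<notin> W" using that by (auto simp: qs_def set_remaining)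
    then have "\<forall>i\<in>W. t i \<noteq> t q" using W inj by (auto dest: inj_onD)
    moreover have "{i\<in>W. t q < t i} = {i\<in>W. q < i}" using W q t_less by auto
    ultimately show ?thesis using sign_prod_linear[OF fin, of t "t q"] by (simp add: g_def \<sigma>_def)
  qed
  have runs_sum: "runs (map \<sigma> qs) + runs (map even qs) = Suc (length qs)" if "qs \<noteq> []"
    using runs_add_runs[OF successively_remaining[OF W]] that by (simp add: qs_def \<sigma>_def)
  show ?thesis unfolding n_def[symmetric] qs_def[symmetric]
  proof (intro iffI conjI)
    assume "W \<noteq> {..<n} \<and> (\<exists>p. degree p \<le> 2 * k \<and> (\<forall>i\<in>W. poly p (t i) = 0) \<and>
       (\<forall>i\<in>{..<n} - W. poly p (t i) > 0))"
    then obtain p where "W \<noteq> {..<n}" and p: "degree p \<le> 2 * k" "\<forall>i\<in>W. poly p (t i) = 0"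
      "\<forall>i\<in>set qs. poly p (t i) > 0" by (auto simp: qs_def set_remaining)
    with W have ne: "qs \<noteq> []" using set_remaining[of n W] by (auto simp: qs_def)
    obtain h where h: "p = g * h"
      using prod_linear_dvd[OF fin inj_on_subset[OF inj W] p(2)] by (auto simp: g_def)
    have "p \<noteq> 0" using p(3) ne by (cases qs) auto
    then have deg: "degree p = card W + degree h"
      using h degree_prod_linear[of t W] by (auto simp: g_def[symmetric] degree_mult_eq)
    have h_sign: "poly h (t q) \<noteq> 0 \<and> (poly h (t q) > 0) = \<sigma> q" if "q \<in> set qs" for q
      using g_sign[OF that] p(3) that unfolding h
      by (auto simp: zero_less_mult_iff split: if_splits)
    have "runs (map (\<lambda>x. poly h x > 0) (map t qs)) \<le> Suc (degree h)"
      using sorted_t ne h_sign by (intro sign_runs_le_degree) auto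
    moreover have "map (\<lambda>x. poly h x > 0) (map t qs) = map \<sigma> qs"
      using h_sign by simp
    ultimately have "runs (map \<sigma> qs) \<le> Suc (degree h)" by (simp only:)
    then show "m \<le> runs (map even qs)"
      using runs_sum[OF ne] len deg p(1) by (simp add: n_def)
  next
    assume m: "m \<le> runs (map even qs)"
    then have ne: "qs \<noteq> []" using \<open>m > 0\<close> by auto
    then show "W \<noteq> {..<n}" using set_remaining[of n W] by (auto simp: qs_def)
    \<comment> \<open>Signs are to be prescribed at real parameters, so \<open>\<sigma>\<close> is
      carried over from positions by the inverse of \<open>t\<close>.\<close>
    define \<tau> where "\<tau> = \<sigma> \<circ> the_inv_into {..<n} t"
    have \<tau>: "\<tau> (t q) = \<sigma> q" if "q \<in> set qs" for q
      using that the_inv_into_f_f[OF inj] by (auto simp: \<tau>_def qs_def set_remaining)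
    obtain h where h: "degree h < runs (map \<tau> (map t qs))"
      "\<forall>x\<in>set (map t qs). if \<tau> x then poly h x > 0 else poly h x < 0"
      using poly_with_signs[OF sorted_t] ne by blast
    have "map \<tau> (map t qs) = map \<sigma> qs" using \<tau> by simp
    then have "degree h < runs (map \<sigma> qs)" using h(1) by (simp only:)
    then have "degree h + m \<le> length qs" using runs_sum[OF ne] m by simp
    moreover have "degree (g * h) \<le> card W + degree h"
      using degree_mult_le[of g h] degree_prod_linear[of t W] by (simp add: g_def)
    ultimately have "degree (g * h) \<le> 2 * k" using len by (simp add: n_def)
    moreover have "\<forall>i\<in>W. poly (g * h) (t i) = 0"
      using fin by (auto simp: g_def poly_prod)
    moreover have "poly (g * h) (t q) > 0" if "q \<in> set qs" for q
      using g_sign[OF that] h(2) \<tau>[OF that] that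
      by (auto simp: zero_less_mult_iff split: if_splits)
    ultimately show "\<exists>p. degree p \<le> 2 * k \<and> (\<forall>i\<in>W. poly p (t i) = 0) \<and>
       (\<forall>i\<in>{..<n} - W. poly p (t i) > 0)"
      by (intro exI[of _ "g * h"]) (auto simp: qs_def set_remaining)
  qed
qed

section \<open>Faces of cyclic polytopes\<close>

lemma inner_moment_curve:
  "a \<bullet> moment_curve e x = poly (\<Sum>i\<in>UNIV. monom (a $ i) (e i)) x"
  by (simp add: moment_curve_def inner_vec_def poly_sum poly_monom)

text \<open>Coefficients of positive degree form a normal vector; the constant term, which no
  coordinate of the curve provides, becomes the offset.\<close>

lemma poly_as_inner_moment_curve:
  fixes e :: "'d::finite \<Rightarrow> nat"
  assumes e: "bij_betw e UNIV {1..CARD('d)}" and p: "degree p \<le> CARD('d)"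
  shows "poly p x = coeff p 0 + (\<chi> i. coeff p (e i)) \<bullet> moment_curve e x"
proof -
  have "poly p x = (\<Sum>j\<le>CARD('d). coeff p j * x ^ j)"
    using arg_cong[OF poly_as_sum_of_monoms'[OF p], of "\<lambda>q. poly q x"]
    by (simp add: poly_sum poly_monom)
  also have "{..CARD('d)} = insert 0 {1..CARD('d)}" by auto
  also have "(\<Sum>j\<in>insert 0 {1..CARD('d)}. coeff p j * x ^ j) =
      coeff p 0 + (\<Sum>j\<in>{1..CARD('d)}. coeff p j * x ^ j)" by simp
  also have "(\<Sum>j\<in>{1..CARD('d)}. coeff p j * x ^ j) = (\<Sum>i\<in>UNIV. coeff p (e i) * x ^ e i)"
    using sum.reindex_bij_betw[OF e, of "\<lambda>j. coeff p j * x ^ j"] by simp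
  finally show ?thesis by (simp add: moment_curve_def inner_vec_def)
qed

lemma inj_moment_curve:
  fixes e :: "'d::finite \<Rightarrow> nat"
  assumes e: "bij_betw e UNIV {1..CARD('d)}"
  shows "inj (moment_curve e)"
proof (rule injI)
  fix x y
  assume eq: "moment_curve e x = moment_curve e y"
  have "1 \<in> {1..CARD('d)}" by (simp add: Suc_le_eq)
  then have "1 \<in> range e" using e by (simp only: bij_betw_def)
  then obtain i where "e i = 1" by auto
  with arg_cong[OF eq, of "\<lambda>v. v $ i"] show "x = y" by (simp add: moment_curve_def)
qed

lemma exposed_face_poly:
  fixes e :: "'d::finite \<Rightarrow> nat"
  assumes e: "bij_betw e UNIV {1..CARD('d)}" and "degree p \<le> CARD('d)"
    and "\<forall>x\<in>T. poly p x \<ge> 0"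
  obtains F where "F face_of (convex hull (moment_curve e ` T))"
    and "\<And>x. x \<in> T \<Longrightarrow> moment_curve e x \<in> F \<longleftrightarrow> poly p x = 0"
proof -
  let ?P = "convex hull (moment_curve e ` T)"
  \<comment> \<open>The sign is flipped because supporting half-spaces are written with an upper
    bound.\<close>
  define a where "a = (\<chi> i. - coeff p (e i))"
  have a: "a \<bullet> moment_curve e x = coeff p 0 - poly p x" for x
  proof -
    have "a = - (\<chi> i. coeff p (e i))" by (simp add: a_def vec_eq_iff)
    then show ?thesis using poly_as_inner_moment_curve[OF assms(1,2), of x] by simp
  qed
  have "?P \<subseteq> {v. a \<bullet> v \<le> coeff p 0}"
    by (rule hull_minimal) (use assms(3) in \<open>auto simp: a convex_halfspace_le\<close>)
  then have "(?P \<inter> {v. a \<bullet> v = coeff p 0}) face_of ?P"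
    by (intro face_of_Int_supporting_hyperplane_le) auto
  moreover have "moment_curve e x \<in> ?P \<inter> {v. a \<bullet> v = coeff p 0} \<longleftrightarrow> poly p x = 0"
    if "x \<in> T" for x
    using that by (auto simp: a intro: hull_inc)
  ultimately show thesis using that by blast
qed

text \<open>The square \<open>(y - x)^2\<close> is nonnegative with sole zero \<open>x\<close>, so
  it exposes a face with the single vertex \<open>v\<close>; its degree 2 is where the dimension
  bound enters.\<close>

lemma extreme_point_cyclic_polytope:
  fixes e :: "'d::finite \<Rightarrow> nat"
  assumes e: "bij_betw e UNIV {1..CARD('d)}" and "CARD('d) \<ge> 2" and "finite T"
  shows "v extreme_point_of (convex hull (moment_curve e ` T)) \<longleftrightarrow> v \<in> moment_curve e ` T"
proof
  show "v extreme_point_of (convex hull (moment_curve e ` T)) \<Longrightarrow> v \<in> moment_curve e ` T"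
    by (rule extreme_point_of_convex_hull)
next
  assume "v \<in> moment_curve e ` T"
  then obtain x where x: "x \<in> T" "v = moment_curve e x" by auto
  let ?P = "convex hull (moment_curve e ` T)"
  define p where "p = [:- x, 1:] ^ 2"
  have p: "poly p y = (y - x)\<^sup>2" for y by (simp add: p_def power2_eq_square algebra_simps)
  have "degree p \<le> CARD('d)" using assms(2) by (simp add: p_def degree_power_eq)
  then obtain F where F: "F face_of ?P" "\<And>y. y \<in> T \<Longrightarrow> moment_curve e y \<in> F \<longleftrightarrow> poly p y = 0"
    using exposed_face_poly[OF e, of p T] p by (metis zero_le_power2)
  have "compact ?P" using assms(3) by (simp add: compact_convex_hull finite_imp_compact)
  then have "compact F" "convex F"
    using F(1) face_of_imp_compact[of ?P] face_of_imp_convex by auto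
  then have "F = convex hull {u. u extreme_point_of F}"
    by (rule Krein_Milman_Minkowski)
  moreover have "{u. u extreme_point_of F} \<subseteq> {v}"
  proof
    fix u assume "u \<in> {u. u extreme_point_of F}"
    then have "u \<in> F" "u extreme_point_of ?P"
      using extreme_point_of_face[OF F(1)] by auto
    with extreme_point_of_convex_hull obtain y where "y \<in> T" "u = moment_curve e y" by blast
    with F(2) \<open>u \<in> F\<close> p x show "u \<in> {v}" by simp
  qed
  moreover have "v \<in> F" using F(2) x p by simp
  \<comment> \<open>\<open>F\<close> is the hull of its extreme points and contains
    \<open>v\<close>, so their set is not empty.\<close>
  ultimately have "v \<in> {u. u extreme_point_of F}"
    by (metis convex_hull_empty empty_iff insertI1 subset_singletonD)
  then show "v extreme_point_of ?P" using extreme_point_of_face[OF F(1)] by simp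
qed

lemma vertex_scheme_cyclic_polytope:
  fixes e :: "'d::finite \<Rightarrow> nat"
  assumes e: "bij_betw e UNIV {1..CARD('d)}" and d: "CARD('d) \<ge> 2" and "finite T"
  shows "vertex_scheme (boundary_complex (convex hull (moment_curve e ` T))) =
    {moment_curve e ` Z | Z. Z \<subseteq> T \<and> Z \<noteq> T \<and> (\<exists>p. degree p \<le> CARD('d) \<and>
       (\<forall>x\<in>Z. poly p x = 0) \<and> (\<forall>x\<in>T - Z. poly p x > 0))}"
    (is "?L = ?R")
proof (intro subset_antisym subsetI)
  let ?P = "convex hull (moment_curve e ` T)"
  have vert: "{v. v extreme_point_of F} = moment_curve e ` T \<inter> F" if "F face_of ?P" for F
    unfolding extreme_point_of_face[OF that] extreme_point_cyclic_polytope[OF assms] by auto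
  have L: "?L = (\<lambda>F. moment_curve e ` T \<inter> F) ` {F. F face_of ?P \<and> F \<noteq> ?P}"
    unfolding vertex_scheme_def boundary_complex_def by (rule image_cong) (simp_all add: vert)
  {
    fix V
    assume "V \<in> ?L"
    then obtain F where F: "F face_of ?P" "F \<noteq> ?P" "V = moment_curve e ` T \<inter> F"
      unfolding L by blast
    have "polyhedron ?P" using assms(3) by (simp add: polyhedron_convex_hull)
    then have "F exposed_face_of ?P" using F(1) exposed_face_of_polyhedron by blast
    then obtain a b where ab: "?P \<subseteq> {v. a \<bullet> v \<le> b}" "F = ?P \<inter> {v. a \<bullet> v = b}"
      by (auto simp: exposed_face_of_def)
    \<comment> \<open>The slack \<open>b - a \<bullet> v\<close> of the supporting hyperplane,
      pulled back along the moment curve.\<close>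
    define p where "p = [:b:] - (\<Sum>i\<in>UNIV. monom (a $ i) (e i))"
    have p: "poly p x = b - a \<bullet> moment_curve e x" for x
      by (simp add: p_def inner_moment_curve)
    have e_le: "e i \<le> CARD('d)" for i
      using bij_betwE[OF e] by auto
    have "degree (monom (a $ i) (e i)) \<le> CARD('d)" for i
      using degree_monom_le[of "a $ i" "e i"] e_le[of i] by linarith
    then have deg: "degree p \<le> CARD('d)"
      unfolding p_def by (intro degree_diff_le degree_sum_le) auto
    define Z where "Z = {x\<in>T. poly p x = 0}"
    have on_F: "moment_curve e x \<in> F \<longleftrightarrow> poly p x = 0" if "x \<in> T" for x
      using that unfolding ab(2) p by (auto simp: hull_inc)
    have nonneg: "poly p x \<ge> 0" if "x \<in> T" for x
    proof -
      have "moment_curve e x \<in> ?P" using that by (simp add: hull_inc)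
      with ab(1) show ?thesis unfolding p by auto
    qed
    \<comment> \<open>Properness of the face: if \<open>p\<close> vanished on \<open>T\<close>, then
      \<open>F\<close> would contain all generators of the hull.\<close>
    have "Z \<noteq> T"
    proof
      assume "Z = T"
      then have "moment_curve e ` T \<subseteq> F" using on_F by (auto simp: Z_def)
      then have "?P \<subseteq> F" using face_of_imp_convex[OF F(1)] by (intro hull_minimal) auto
      with F(1,2) face_of_imp_subset show False by blast
    qed
    moreover have "V = moment_curve e ` Z" using F(3) on_F by (auto simp: Z_def)
    moreover have "Z \<subseteq> T" "\<forall>x\<in>Z. poly p x = 0" by (auto simp: Z_def)
    moreover have "\<forall>x\<in>T - Z. poly p x > 0" using nonneg by (simp add: Z_def less_le)
    ultimately show "V \<in> ?R" using deg by blast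
  next
    fix V
    assume "V \<in> ?R"
    then obtain Z p where Z: "V = moment_curve e ` Z" "Z \<subseteq> T" "Z \<noteq> T" "degree p \<le> CARD('d)"
      "\<forall>x\<in>Z. poly p x = 0" "\<forall>x\<in>T - Z. poly p x > 0" by blast
    have "\<forall>x\<in>T. poly p x \<ge> 0" using Z(5,6) by (metis DiffI less_imp_le order_refl)
    then obtain F where F: "F face_of ?P"
      "\<And>x. x \<in> T \<Longrightarrow> moment_curve e x \<in> F \<longleftrightarrow> poly p x = 0"
      using exposed_face_poly[OF e Z(4)] by blast
    obtain x where "x \<in> T - Z" using Z(2,3) by blast
    then have "moment_curve e x \<notin> F" using F(2) Z(6) by force
    then have "F \<noteq> ?P" using \<open>x \<in> T - Z\<close> by (auto intro: hull_inc)
    moreover have "V = moment_curve e ` T \<inter> F"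
    proof -
      have "x \<in> Z \<longleftrightarrow> moment_curve e x \<in> F" if "x \<in> T" for x
        using Z(5,6) that F(2)[OF that] by (metis DiffI less_irrefl)
      with Z(1,2) show ?thesis by auto
    qed
    ultimately show "V \<in> ?L"
      unfolding L using F(1) by blast
  }
qed

section \<open>Matching positions of the word with points on the moment curve\<close>

theorem theorem6p1:
  fixes m k :: nat
    and c :: "dihedral_gen list set"
    and cw :: "dihedral_gen list"
    and P :: "(real ^ 'd) set"
  assumes "m \<ge> 2" and "k > 0"
    and "coxeter_element (I2 m) c"
    and "reduced_expression (I2 m) c cw"
    and "CARD('d) = 2 * k"
    and "cyclic_polytope (2 * k + m) P"
  shows "complex_isomorphic (multi_cluster_complex (I2 m) k cw)
           (vertex_scheme (boundary_complex P))"
proof -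
  define n where "n = 2 * k + m"
  obtain s where cw: "cw = [s, other s]"
    using reduced_coxeter_element_I2[OF assms(1,3,4)] by blast
  obtain e :: "'d \<Rightarrow> nat" and T where e: "bij_betw e UNIV {1..CARD('d)}"
    and T: "finite T" "card T = n" and P: "P = convex hull (moment_curve e ` T)"
    using assms(6) by (auto simp: cyclic_polytope_def n_def)
  \<comment> \<open>Position \<open>i\<close> corresponds to the \<open>i\<close>-th smallest
    parameter, counted from 0; the parity criterion depends on this order.\<close>
  define t where "t = (\<lambda>i. sorted_list_of_set T ! i)"
  have mono: "strict_mono_on {..<n} t"
    using T sorted_wrt_nth_less[OF strict_sorted_list_of_set[of T]]
    by (auto simp: strict_mono_on_def t_def)
  then have inj_t: "inj_on t {..<n}" by (rule strict_mono_on_imp_inj_on)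
  have T_eq: "T = t ` {..<n}"
    using T nth_image[of n "sorted_list_of_set T"] by (simp add: t_def atLeast0LessThan)
  define f where "f = moment_curve e \<circ> t"
  have inj_f: "inj_on f {..<n}"
    unfolding f_def using inj_t inj_moment_curve[OF e] by (meson comp_inj_on inj_on_subset subset_UNIV)
  let ?K = "multi_cluster_complex (I2 m) k cw"
  \<comment> \<open>One criterion in two forms, for sets of positions and for sets of parameters, so
    that it can be moved along \<open>t\<close>.\<close>
  define face_idx where "face_idx W \<longleftrightarrow> W \<noteq> {..<n} \<and> (\<exists>p. degree p \<le> 2 * k \<and>
      (\<forall>i\<in>W. poly p (t i) = 0) \<and> (\<forall>i\<in>{..<n} - W. poly p (t i) > 0))" for W
  define face_pts where "face_pts Z \<longleftrightarrow> Z \<noteq> T \<and> (\<exists>p. degree p \<le> 2 * k \<and>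
      (\<forall>x\<in>Z. poly p x = 0) \<and> (\<forall>x\<in>T - Z. poly p x > 0))" for Z
  have face_image: "face_pts (t ` W) = face_idx W" if "W \<subseteq> {..<n}" for W
  proof -
    have "T - t ` W = t ` ({..<n} - W)"
      unfolding T_eq using inj_on_image_set_diff[OF inj_t _ that] by simp
    moreover have "t ` W = T \<longleftrightarrow> W = {..<n}"
      unfolding T_eq using inj_on_image_eq_iff[OF inj_t that] by simp
    ultimately show ?thesis by (simp add: face_pts_def face_idx_def)
  qed
  have K: "?K = {W. W \<subseteq> {..<n} \<and> face_idx W}"
    unfolding cw multi_cluster_complex_I2[OF assms(1)] face_idx_def n_def
    using supporting_poly_iff_runs[OF mono[unfolded n_def]] assms(1) by (intro Collect_cong) auto
  have "vertex_scheme (boundary_complex P) = {moment_curve e ` Z | Z. Z \<subseteq> T \<and> face_pts Z}"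
    using vertex_scheme_cyclic_polytope[OF e _ T(1)] assms(2,5) by (simp add: P face_pts_def)
  also have "\<dots> = (`) (moment_curve e) ` {Z. Z \<subseteq> T \<and> face_pts Z}"
    by blast
  also have "{Z. Z \<subseteq> T \<and> face_pts Z} = (`) t ` ?K"
  proof (intro subset_antisym subsetI)
    fix Z
    assume Z: "Z \<in> {Z. Z \<subseteq> T \<and> face_pts Z}"
    then obtain W where W: "W \<subseteq> {..<n}" "Z = t ` W"
      unfolding T_eq subset_image_iff by blast
    with Z face_image[OF W(1)] show "Z \<in> (`) t ` ?K" unfolding K by simp
  next
    fix Z
    assume "Z \<in> (`) t ` ?K"
    then obtain W where W: "W \<subseteq> {..<n}" "face_idx W" "Z = t ` W" unfolding K by blast
    with face_image[OF W(1)] show "Z \<in> {Z. Z \<subseteq> T \<and> face_pts Z}" by (simp add: T_eq image_mono)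
  qed
  also have "(`) (moment_curve e) ` (`) t ` ?K = (`) f ` ?K"
    by (simp add: f_def image_image image_comp)
  finally have L: "vertex_scheme (boundary_complex P) = (`) f ` ?K" .
  \<comment> \<open>An isomorphism is a bijection between the vertices that occur in faces, so
    injectivity of \<open>f\<close> on all positions is restricted to these.\<close>
  have "\<Union> ?K \<subseteq> {..<n}" unfolding K by auto
  then have "bij_betw f (\<Union> ?K) (\<Union> ((`) f ` ?K))"
    using inj_on_subset[OF inj_f] by (auto simp: bij_betw_def image_Union)
  then show ?thesis unfolding complex_isomorphic_def L by blast
qed

end
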